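(* Let $S$ be a Polish space, $P:S\twoheadrightarrow S$ a stochastic effectivity function, and $R$ a smooth state bisimulation equivalence on $P$. Then the $\sigma$-algebra $\Sigma_R$ of $R$-invariant Borel subsets of $S$ is a subsystem of $P$. In particular, if $P$ is finitary, then the $\sigma$-algebra of Borel sets invariant under state bisimilarity $\sim_s$ is a subsystem of $P$.
   Context: $\mathcal{S}(X)$ is the set of subprobability measures on a measurable space $X$ with the $\sigma$-algebra $w(X)$ generated by $\{\mu\mid\mu(A)\bowtie q\}$. A stochastic effectivity function $P:S\twoheadrightarrow S$ assigns to each $s$ an upper closed subset $P(s)\subseteq w(S)$ (w.r.t. Borel sets of $S$) such that for each $H\in w(S)\otimes\mathcal{B}([0,1])$, $\{\langle s,q\rangle\mid H_q\in P(s)\}\in\mathcal{B}(S)\otimes\mathcal{B}([0,1])$ with $H_q=\{\mu\mid\langle\mu,q\rangle\in H\}$ (t-measurability). For a sub-$\sigma$-algebra $\mathcal{C}$ of the Borel sets, $i_{\mathcal{C}}:(S,\mathcal{B}(S))\to(S,\mathcal{C})$ is the identity and $\mathcal{S}i_{\mathcal{C}}$ restricts a measure to $\mathcal{C}$. $\mathcal{C}$ is a subsystem of $P$ iff the map $P_{\mathcal{C}}(x):=\{D\in w(S,\mathcal{C})\mid(\mathcal{S}i_{\mathcal{C}})^{-1}[D]\in P(x)\}$ is t-measurable w.r.t. $\mathcal{C}$, i.e. for each $H\in w(S,\mathcal{C})\otimes\mathcal{B}([0,1])$, $\{\langle s,q\rangle\mid H_q\in P_{\mathcal{C}}(s)\}\in\mathcal{C}\otimes\mathcal{B}([0,1])$.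 A set is $R$-closed (invariant) if $x$ in it and $xRy$ imply $y$ in it; $\mu\,\bar R\,\nu$ iff $\mu,\nu$ agree on all Borel $R$-closed sets. A state bisimulation on $P$ is a symmetric relation $R$ such that whenever $sRt$, for each $A\in P(s)$ there is $B\in P(t)$ such that for each $\nu\in B$ there is $\mu\in A$ with $\mu\,\bar R\,\nu$; a state bisimulation equivalence is a state bisimulation that is an equivalence relation. $s\sim_s t$ iff some state bisimulation relates $s$ and $t$. An equivalence relation $\rho$ on $S$ is smooth if there is a countable family $(C_n)$ of Borel sets with $s\rho t$ iff $\forall n\,(s\in C_n\Leftrightarrow t\in C_n)$. With $\mathfrak{F}(W)=\{U\in w(S)\mid W\subseteq U\}$, $P$ is finitary if for each $s$ there are finitely many finite sets $\kappa_1(s),\dots,\kappa_{n_s}(s)$ of subprobabilities with $P(s)=\bigcup_i\mathfrak{F}(\kappa_i(s))$. *)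

theory Defs
  imports "HOL-Probability.Probability"
begin

text \<open>
  The set \<open>\<S>(X)\<close> of subprobabilities on \<open>X\<close> and the \<open>\<sigma>\<close>-algebra \<open>w(X)\<close> are
  \<open>space (subprob_algebra X)\<close> and \<open>sets (subprob_algebra X)\<close>. A sub-\<open>\<sigma>\<close>-algebra is
  given by its family \<open>C\<close> of sets; the corresponding measurable space is \<open>sigma UNIV C\<close>.
\<close>

abbreviation unit_interval_borel :: "real measure" where
  "unit_interval_borel \<equiv> restrict_space borel {0..1}"

definition t_measurable :: "'a measure \<Rightarrow> ('a \<Rightarrow> 'a measure set set) \<Rightarrow> bool" where
  "t_measurable M P \<longleftrightarrow>
     (\<forall>H \<in> sets (subprob_algebra M \<Otimes>\<^sub>M unit_interval_borel).
        {(s, q). s \<in> space M \<and> q \<in> {0..1} \<and> {\<mu>. (\<mu>, q) \<in> H} \<in> P s}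
          \<in> sets (M \<Otimes>\<^sub>M unit_interval_borel))"

definition stochastic_effectivity_function ::
  "('a::topological_space \<Rightarrow> 'a measure set set) \<Rightarrow> bool" where
  "stochastic_effectivity_function P \<longleftrightarrow>
     (\<forall>s. P s \<subseteq> sets (subprob_algebra borel)) \<and>
     (\<forall>s. \<forall>A \<in> P s. \<forall>B \<in> sets (subprob_algebra borel). A \<subseteq> B \<longrightarrow> B \<in> P s) \<and>
     t_measurable borel P"

text \<open>
  \<open>distr \<mu> (sigma UNIV C) (\<lambda>x. x)\<close> is the image of \<open>\<mu>\<close> under the identity
  \<open>(S, \<B>(S)) \<rightarrow> (S, C)\<close>, i.e. the restriction of \<open>\<mu>\<close> to \<open>C\<close>.
\<close>

definition restricted_effectivity ::
  "('a::topological_space \<Rightarrow> 'a measure set set) \<Rightarrow> 'a set set \<Rightarrow> 'a \<Rightarrow> 'a measure set set" where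
  "restricted_effectivity P C x =
     {D \<in> sets (subprob_algebra (sigma UNIV C)).
        {\<mu> \<in> space (subprob_algebra borel). distr \<mu> (sigma UNIV C) (\<lambda>x. x) \<in> D} \<in> P x}"

definition subsystem ::
  "('a::topological_space \<Rightarrow> 'a measure set set) \<Rightarrow> 'a set set \<Rightarrow> bool" where
  "subsystem P C \<longleftrightarrow>
     sigma_algebra UNIV C \<and> C \<subseteq> sets borel \<and>
     t_measurable (sigma UNIV C) (restricted_effectivity P C)"

definition invariant_set :: "('a \<Rightarrow> 'a \<Rightarrow> bool) \<Rightarrow> 'a set \<Rightarrow> bool" where
  "invariant_set R A \<longleftrightarrow> (\<forall>x y. x \<in> A \<longrightarrow> R x y \<longrightarrow> y \<in> A)"

definition invariant_borel_sets :: "('a::topological_space \<Rightarrow> 'a \<Rightarrow> bool) \<Rightarrow> 'a set set" where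
  "invariant_borel_sets R = {A \<in> sets borel. invariant_set R A}"

definition lift_rel ::
  "('a::topological_space \<Rightarrow> 'a \<Rightarrow> bool) \<Rightarrow> 'a measure \<Rightarrow> 'a measure \<Rightarrow> bool" where
  "lift_rel R \<mu> \<nu> \<longleftrightarrow> (\<forall>A \<in> invariant_borel_sets R. emeasure \<mu> A = emeasure \<nu> A)"

definition state_bisimulation ::
  "('a::topological_space \<Rightarrow> 'a measure set set) \<Rightarrow> ('a \<Rightarrow> 'a \<Rightarrow> bool) \<Rightarrow> bool" where
  "state_bisimulation P R \<longleftrightarrow>
     symp R \<and>
     (\<forall>s t. R s t \<longrightarrow>
        (\<forall>A \<in> P s. \<exists>B \<in> P t. \<forall>\<nu> \<in> B. \<exists>\<mu> \<in> A. lift_rel R \<mu> \<nu>))"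

definition state_bisimulation_equivalence ::
  "('a::topological_space \<Rightarrow> 'a measure set set) \<Rightarrow> ('a \<Rightarrow> 'a \<Rightarrow> bool) \<Rightarrow> bool" where
  "state_bisimulation_equivalence P R \<longleftrightarrow> state_bisimulation P R \<and> equivp R"

definition state_bisimilar ::
  "('a::topological_space \<Rightarrow> 'a measure set set) \<Rightarrow> 'a \<Rightarrow> 'a \<Rightarrow> bool" where
  "state_bisimilar P s t \<longleftrightarrow> (\<exists>R. state_bisimulation P R \<and> R s t)"

definition smooth_equivalence :: "('a::topological_space \<Rightarrow> 'a \<Rightarrow> bool) \<Rightarrow> bool" where
  "smooth_equivalence R \<longleftrightarrow>
     equivp R \<and>
     (\<exists>C :: nat \<Rightarrow> 'a set. (\<forall>n. C n \<in> sets borel) \<and>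
        (\<forall>s t. R s t \<longleftrightarrow> (\<forall>n. s \<in> C n \<longleftrightarrow> t \<in> C n)))"

definition principal_filter ::
  "'a::topological_space measure set \<Rightarrow> 'a measure set set" where
  "principal_filter W = {U \<in> sets (subprob_algebra borel). W \<subseteq> U}"

definition finitary :: "('a::topological_space \<Rightarrow> 'a measure set set) \<Rightarrow> bool" where
  "finitary P \<longleftrightarrow>
     (\<forall>s. \<exists>K. finite K \<and>
        (\<forall>\<kappa> \<in> K. finite \<kappa> \<and> \<kappa> \<subseteq> space (subprob_algebra borel)) \<and>
        P s = (\<Union>\<kappa> \<in> K. principal_filter \<kappa>))"

end

theory Submission imports Defs begin

text \<open>
  Restriction to \<open>\<Sigma>\<^sub>R\<close> does not see the difference between lifting-related measures, so the bisimulation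
  property makes the set \<open>{(s, q). H\<^sub>q \<in> P\<^sub>\<C> s}\<close>, which is Borel by t-measurability of \<open>P\<close>,
  invariant under \<open>R\<close> in its first coordinate. Smoothness gives a Borel map \<open>code\<close> into a Polish space
  whose kernel is \<open>R\<close>, and by the Blackwell-Mackey theorem (a consequence of Lusin's separation
  theorem) a Borel set saturated for \<open>(s, q) \<mapsto> (code s, q)\<close> is the preimage of a Borel set, hence
  lies in \<open>\<Sigma>\<^sub>R \<otimes> \<B>([0,1])\<close>.

  For finitary \<open>P\<close>, bisimilarity coincides with equivalence in a countable modal logic, which is
  smooth. That logical equivalence is a bisimulation uses Blackwell-Mackey once more: its invariant
  Borel sets are generated by the \<open>\<pi>\<close>-system of denotations of formulas, so subprobabilities agreeing
  on formulas are related by the lifting.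
\<close>

section \<open>Lusin separation and the Blackwell-Mackey theorem\<close>

text \<open>Analytic sets, as projections of closed sets along Baire space
  \<open>nat => nat discrete\<close>. A sequence of parameters can be recoded as one parameter, so
  this fixed space serves countable unions and intersections; being Polish, it also suits
  \<open>lusin_separation\<close>.\<close>

definition souslin :: "'a::topological_space set \<Rightarrow> bool" where
  "souslin A \<longleftrightarrow> (\<exists>F :: ('a \<times> (nat \<Rightarrow> nat discrete)) set. closed F \<and> A = fst ` F)"

lemma souslin_closed: "closed C \<Longrightarrow> souslin C"
  unfolding souslin_def by (intro exI[of _ "C \<times> UNIV"]) (auto intro: closed_Times)

text \<open>Entry \<open>0\<close> of the parameter names a member of the union, and the shifted
  sequence in \<open>tl\<close> is a parameter for that member.\<close>

lemma souslin_UN: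
  assumes "\<And>n::nat. souslin (A n)"
  shows "souslin (\<Union>n. A n)"
proof -
  obtain F where F: "\<And>n. closed (F n)" "\<And>n. A n = fst ` (F n :: ('a \<times> (nat \<Rightarrow> nat discrete)) set)"
    using assms unfolding souslin_def by metis
  define tl where "tl = (\<lambda>p :: 'a \<times> (nat \<Rightarrow> nat discrete). (fst p, \<lambda>k. snd p (Suc k)))"
  have tl: "continuous_on UNIV tl"
    unfolding tl_def
    by (intro continuous_intros continuous_on_coordinatewise_then_product
        continuous_on_compose2[OF continuous_on_product_coordinates]) auto
  have hd: "continuous_on UNIV (\<lambda>p :: 'a \<times> (nat \<Rightarrow> nat discrete). snd p 0)"
    by (intro continuous_intros continuous_on_compose2[OF continuous_on_product_coordinates]) auto
  define G where "G = {p. tl p \<in> F (of_discrete (snd p 0))}"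
  \<comment> \<open>Fixing entry \<open>0\<close>, which ranges over a discrete space, is an open
    condition, so the complement of \<open>G\<close> is a union of open sets.\<close>
  have "- G = (\<Union>n. (\<lambda>p. snd p 0) -` {discrete n} \<inter> tl -` (- F n))"
    by (auto simp: G_def of_discrete_inverse discrete_inverse) 
  also have "open \<dots>"
    using hd tl F(1) by (intro open_UN ballI open_Int open_vimage open_discrete) auto
  finally have "closed G" by (simp add: closed_open Compl_eq_Diff_UNIV)
  moreover have "(\<Union>n. A n) = fst ` G"
  proof safe
    fix x n assume "x \<in> A n"
    then obtain \<alpha> where \<alpha>: "(x, \<alpha>) \<in> F n" unfolding F(2) by auto
    have "(x, case_nat (discrete n) \<alpha>) \<in> G"
      using \<alpha> by (simp add: G_def tl_def discrete_inverse)
    then show "x \<in> fst ` G" by force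
  next
    fix p assume "p \<in> G"
    then show "fst p \<in> (\<Union>n. A n)"
      unfolding F(2) G_def by (auto simp: tl_def intro!: image_eqI[of _ _ "tl p"])
  qed
  ultimately show ?thesis unfolding souslin_def by blast
qed

text \<open>Via \<open>prod_encode\<close> one parameter carries a whole sequence of them;
  \<open>row n\<close> reads off the one for \<open>A n\<close>.\<close>

lemma souslin_INT:
  assumes "\<And>n::nat. souslin (A n)"
  shows "souslin (\<Inter>n. A n)"
proof -
  obtain F where F: "\<And>n. closed (F n)" "\<And>n. A n = fst ` (F n :: ('a \<times> (nat \<Rightarrow> nat discrete)) set)"
    using assms unfolding souslin_def by metis
  define row where "row = (\<lambda>n (p :: 'a \<times> (nat \<Rightarrow> nat discrete)). (fst p, \<lambda>k. snd p (prod_encode (n, k))))"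
  have row: "continuous_on UNIV (row n)" for n
    unfolding row_def
    by (intro continuous_intros continuous_on_coordinatewise_then_product
        continuous_on_compose2[OF continuous_on_product_coordinates]) auto
  define G where "G = (\<Inter>n. row n -` F n)"
  have "closed G"
    unfolding G_def using row F(1) by (intro closed_INT ballI closed_vimage) auto
  moreover have "(\<Inter>n. A n) = fst ` G"
  proof safe
    fix x assume "x \<in> (\<Inter>n. A n)"
    then have "\<forall>n. \<exists>\<alpha>. (x, \<alpha>) \<in> F n" unfolding F(2) by force
    then obtain \<alpha> where \<alpha>: "\<And>n. (x, \<alpha> n) \<in> F n" by metis
    have "(x, \<lambda>m. \<alpha> (fst (prod_decode m)) (snd (prod_decode m))) \<in> G"
      using \<alpha> by (simp add: G_def row_def)
    then show "x \<in> fst ` G" by force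
  next
    fix p n assume "p \<in> G"
    then show "fst p \<in> A n"
      unfolding F(2) G_def by (auto simp: row_def intro!: image_eqI[of _ _ "row n p"])
  qed
  ultimately show ?thesis unfolding souslin_def by blast
qed

lemma souslin_open:
  fixes U :: "'a::metric_space set"
  assumes "open U"
  shows "souslin U"
proof -
  have "fsigma_in euclidean U"
    using assms by (intro open_imp_fsigma_in) (auto simp: metrizable_space_euclidean)
  then obtain C :: "nat \<Rightarrow> 'a set" where "\<And>n. closed (C n)" "(\<Union>n. C n) = U"
    unfolding fsigma_in_ascending by auto
  then show ?thesis using souslin_UN[of C] souslin_closed by auto
qed

text \<open>Souslin sets need not have Souslin complements, so the induction carries a set together
  with its complement; complementation exchanges countable unions and intersections.\<close>

lemma souslin_borel:
  fixes A :: "'a::metric_space set"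
  assumes "A \<in> sets borel"
  shows "souslin A"
proof -
  have "A \<in> sigma_sets UNIV (Collect closed)"
    using assms by (simp add: borel_eq_closed)
  then have "souslin A \<and> souslin (- A)"
  proof induction
    case (Basic C)
    then show ?case by (auto intro: souslin_closed souslin_open)
  next
    case (Union A)
    then show ?case by (auto intro: souslin_UN souslin_INT simp: Compl_UN)
  qed (auto intro: souslin_closed simp: Compl_eq_Diff_UNIV[symmetric])
  then show ?thesis ..
qed

section \<open>Borel separation of continuous images of closed sets\<close>

definition borel_separated :: "'a::topological_space set \<Rightarrow> 'a set \<Rightarrow> bool" where
  "borel_separated A B \<longleftrightarrow> (\<exists>D \<in> sets borel. A \<subseteq> D \<and> D \<inter> B = {})"

text \<open>If \<open>D m n\<close> separates \<open>A m\<close> from \<open>B n\<close>, then the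
  union over \<open>m\<close> of the intersections over \<open>n\<close> separates the unions. Read
  contrapositively, unseparated unions contain an unseparated pair of pieces.\<close>

lemma borel_separated_UN:
  assumes "\<And>(m::nat) (n::nat). borel_separated (A m) (B n)"
  shows "borel_separated (\<Union>m. A m) (\<Union>n. B n)"
proof -
  obtain D where D: "\<And>m n. D m n \<in> sets borel" "\<And>m n. A m \<subseteq> D m n" "\<And>m n. D m n \<inter> B n = {}"
    using assms[unfolded borel_separated_def] by metis
  have "(\<Inter>n. D m n) \<in> sets borel" for m
    by (rule sets.countable_INT[OF image_subsetI]) (rule D(1), simp)
  then have "(\<Union>m. \<Inter>n. D m n) \<in> sets borel"
    by (rule sets.countable_UN[OF image_subsetI])
  moreover have "(\<Union>m. A m) \<subseteq> (\<Union>m. \<Inter>n. D m n)" by (intro UN_mono INT_greatest D(2)) auto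
  moreover have "(\<Union>m. \<Inter>n. D m n) \<inter> (\<Union>n. B n) = {}"
  proof (safe, simp)
    fix x m n assume "\<forall>n. x \<in> D m n" "x \<in> B n"
    then show False using D(3)[of m n] by blast
  qed
  ultimately show ?thesis unfolding borel_separated_def by (intro bexI conjI)
qed

lemma countable_cover_cball:
  assumes "e > 0"
  obtains a :: "nat \<Rightarrow> 'a::{metric_space, second_countable_topology}"
  where "(\<Union>n. cball (a n) e) = UNIV"
proof -
  obtain D :: "'a set" where D: "countable D" "\<And>X. open X \<Longrightarrow> X \<noteq> {} \<Longrightarrow> \<exists>d\<in>D. d \<in> X"
    using countable_dense_exists by metis
  have ne: "D \<noteq> {}" using D(2)[of UNIV] by auto
  have "x \<in> (\<Union>n. cball (from_nat_into D n) e)" for x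
  proof -
    obtain d where "d \<in> D" "d \<in> ball x e" using D(2)[of "ball x e"] assms by auto
    moreover obtain n where "d = from_nat_into D n"
      using \<open>d \<in> D\<close> D(1) ne by (metis from_nat_into_surj)
    ultimately show ?thesis by (auto simp: dist_commute intro!: exI[of _ n])
  qed
  then show thesis using that by blast
qed

text \<open>
  If the images were not separated, neither would be those of suitable nested closed pieces whose
  diameters tend to \<open>0\<close>. The pieces shrink to points with different images, and disjoint
  neighbourhoods of these images separate late pieces.
\<close>
theorem lusin_separation:
  fixes p :: "'w::polish_space \<Rightarrow> 'y::t2_space"
  assumes p: "continuous_on UNIV p" and F: "closed F" and G: "closed G"
    and disj: "p ` F \<inter> p ` G = {}"
  shows "borel_separated (p ` F) (p ` G)"
proof (rule ccontr)
  assume nsep: "\<not> borel_separated (p ` F) (p ` G)"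
  define Q where "Q = (\<lambda>(n::nat) (U, V). closed U \<and> closed V \<and> U \<subseteq> F \<and> V \<subseteq> G \<and>
    \<not> borel_separated (p ` U) (p ` V))"
  define r where "r = (\<lambda>(n::nat) (U :: 'w set, V :: 'w set) (U' :: 'w set, V' :: 'w set).
    U' \<subseteq> U \<and> V' \<subseteq> V \<and> (\<exists>a. U' \<subseteq> cball a (inverse (Suc n))) \<and> (\<exists>b. V' \<subseteq> cball b (inverse (Suc n))))"
  have "\<exists>f. \<forall>n. Q n (f n) \<and> r n (f n) (f (Suc n))"
  proof (rule dependent_nat_choice)
    show "\<exists>x. Q 0 x" using F G nsep by (intro exI[of _ "(F, G)"]) (auto simp: Q_def)
    fix x n assume "Q n x"
    obtain U V where x: "x = (U, V)" by (cases x)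
    with \<open>Q n x\<close> have UV: "closed U" "closed V" "U \<subseteq> F" "V \<subseteq> G"
      "\<not> borel_separated (p ` U) (p ` V)" by (auto simp: Q_def)
    obtain a :: "nat \<Rightarrow> 'w" where a: "(\<Union>k. cball (a k) (inverse (Suc n))) = UNIV"
      using countable_cover_cball[of "inverse (real (Suc n))"] by auto
    have un: "p ` W = (\<Union>k. p ` (W \<inter> cball (a k) (inverse (Suc n))))" for W
      using a by blast
    \<comment> \<open>The balls cut both images into countably many pieces; if all pairs of pieces
      were separated, so would be the images of \<open>U\<close> and \<open>V\<close>.\<close>
    obtain j k where jk: "\<not> borel_separated (p ` (U \<inter> cball (a j) (inverse (Suc n))))
      (p ` (V \<inter> cball (a k) (inverse (Suc n))))"
      using UV(5) borel_separated_UN[of "\<lambda>j. p ` (U \<inter> cball (a j) (inverse (Suc n)))"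
        "\<lambda>k. p ` (V \<inter> cball (a k) (inverse (Suc n)))"]
      unfolding un[symmetric] by blast
    show "\<exists>y. Q (Suc n) y \<and> r n x y"
      using jk UV x
      by (intro exI[of _ "(U \<inter> cball (a j) (inverse (Suc n)), V \<inter> cball (a k) (inverse (Suc n)))"])
        (auto simp: Q_def r_def)
  qed
  then obtain f where f: "\<And>n. Q n (f n)" "\<And>n. r n (f n) (f (Suc n))" by auto
  define U where "U = fst \<circ> f"
  define V where "V = snd \<circ> f"
  have UV: "closed (U n)" "closed (V n)" "U n \<subseteq> F" "V n \<subseteq> G" "\<not> borel_separated (p ` U n) (p ` V n)" for n
    using f(1)[of n] by (auto simp: Q_def U_def V_def split: prod.splits)
  have UV2: "U (Suc n) \<subseteq> U n" "V (Suc n) \<subseteq> V n"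
    "\<exists>a. U (Suc n) \<subseteq> cball a (inverse (Suc n))" "\<exists>a. V (Suc n) \<subseteq> cball a (inverse (Suc n))" for n
    using f(2)[of n] by (auto simp: r_def U_def V_def split: prod.splits)
  \<comment> \<open>An empty image would be separated from any other set, by the empty set or by the
    whole space.\<close>
  have ne: "U n \<noteq> {}" "V n \<noteq> {}" for n
    using UV(5)[of n] by (auto simp: borel_separated_def)
  \<comment> \<open>Cantor's intersection theorem. The radius bound starts at \<open>W 1\<close>;
    nothing bounds the diameter of \<open>W 0\<close>.\<close>
  have shrink: "\<exists>x. (\<forall>n. x \<in> W n) \<and> (\<forall>O'. open O' \<longrightarrow> x \<in> O' \<longrightarrow> (\<exists>n. \<forall>m\<ge>n. W m \<subseteq> O'))"
    if W: "\<And>n. closed (W n)" "\<And>n. W n \<noteq> {}" "\<And>n. W (Suc n) \<subseteq> W n"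
      "\<And>n. \<exists>a. W (Suc n) \<subseteq> cball a (inverse (Suc n))" for W :: "nat \<Rightarrow> 'w set"
  proof -
    have mono: "W n \<subseteq> W m" if "m \<le> n" for m n
      using lift_Suc_antimono_le[of W, OF W(3) that] .
    have small: "\<exists>n. \<forall>x\<in>W n. \<forall>y\<in>W n. dist x y < e" if "e > 0" for e
    proof -
      obtain n where n: "inverse (real (Suc n)) < e / 2" using \<open>e > 0\<close> reals_Archimedean[of "e/2"] by auto
      obtain a where a: "W (Suc n) \<subseteq> cball a (inverse (Suc n))" using W(4) by blast
      have "dist x y < e" if "x \<in> W (Suc n)" "y \<in> W (Suc n)" for x y
      proof -
        have "dist a x \<le> inverse (real (Suc n))" "dist a y \<le> inverse (real (Suc n))"
          using a that by auto
        then show ?thesis using n dist_triangle3[of x y a] by linarith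
      qed
      then show ?thesis by blast
    qed
    obtain x where x: "\<And>n. x \<in> W n"
      by (rule decreasing_closed_nest[OF W(1,2) mono small]) auto
    have "\<exists>n. \<forall>m\<ge>n. W m \<subseteq> O'" if "open O'" "x \<in> O'" for O'
    proof -
      obtain e where e: "e > 0" "ball x e \<subseteq> O'" using \<open>open O'\<close> \<open>x \<in> O'\<close> openE by blast
      obtain n where n: "\<forall>y\<in>W n. \<forall>z\<in>W n. dist y z < e" using small[OF e(1)] by blast
      have "W n \<subseteq> ball x e" using n x by auto
      then have "W m \<subseteq> O'" if "n \<le> m" for m using mono[OF that] e(2) by blast
      then show ?thesis by blast
    qed
    with x show ?thesis by blast
  qed
  obtain u where u: "\<And>n. u \<in> U n" "\<And>O'. open O' \<Longrightarrow> u \<in> O' \<Longrightarrow> \<exists>n. \<forall>m\<ge>n. U m \<subseteq> O'"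
    using shrink[OF UV(1) ne(1) UV2(1,3)] by blast
  obtain v where v: "\<And>n. v \<in> V n" "\<And>O'. open O' \<Longrightarrow> v \<in> O' \<Longrightarrow> \<exists>n. \<forall>m\<ge>n. V m \<subseteq> O'"
    using shrink[OF UV(2) ne(2) UV2(2,4)] by blast
  have "p u \<noteq> p v" using u(1) v(1) UV(3,4) disj by blast
  then obtain O1 O2 where O: "open O1" "open O2" "p u \<in> O1" "p v \<in> O2" "O1 \<inter> O2 = {}"
    by (metis hausdorff)
  obtain n1 where n1: "\<forall>m\<ge>n1. U m \<subseteq> p -` O1"
    using u(2)[of "p -` O1"] O p by (auto intro: open_vimage)
  obtain n2 where n2: "\<forall>m\<ge>n2. V m \<subseteq> p -` O2"
    using v(2)[of "p -` O2"] O p by (auto intro: open_vimage)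
  have "U (max n1 n2) \<subseteq> p -` O1" "V (max n1 n2) \<subseteq> p -` O2" using n1 n2 by auto
  then have "borel_separated (p ` U (max n1 n2)) (p ` V (max n1 n2))"
    using O unfolding borel_separated_def by (intro bexI[of _ O1]) auto
  with UV(5) show False by blast
qed

instance prod :: (polish_space, polish_space) polish_space ..

text \<open>Passing to the graph of \<open>f\<close> turns images under \<open>f\<close> into continuous images of closed sets.\<close>
theorem blackwell_mackey:
  fixes f :: "'x::polish_space \<Rightarrow> 'y::polish_space"
  assumes f[measurable]: "f \<in> borel_measurable borel" and G: "G \<in> sets borel"
    and inv: "\<And>x y. f x = f y \<Longrightarrow> x \<in> G \<Longrightarrow> y \<in> G"
  obtains D where "D \<in> sets borel" "G = f -` D"
proof -
  have graph: "\<exists>F :: (('x \<times> 'y) \<times> (nat \<Rightarrow> nat discrete)) set.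
      closed F \<and> f ` A = (\<lambda>w. snd (fst w)) ` F" if [measurable]: "A \<in> sets borel" for A
  proof -
    \<comment> \<open>Equality is a measurable condition on pairs in a second countable Hausdorff
      space, so the graph of \<open>f\<close> over \<open>A\<close> is Borel.\<close>
    have "{z \<in> space (borel \<Otimes>\<^sub>M borel). fst z \<in> A \<and> snd z = f (fst z)} \<in> sets (borel \<Otimes>\<^sub>M borel)"
      by measurable
    then have "souslin {z. fst z \<in> A \<and> snd z = f (fst z)}"
      unfolding borel_prod by (intro souslin_borel) simp
    then obtain F :: "(('x \<times> 'y) \<times> (nat \<Rightarrow> nat discrete)) set" where
      F: "closed F" "{z. fst z \<in> A \<and> snd z = f (fst z)} = fst ` F"
      unfolding souslin_def by blast
    have "f ` A = snd ` {z. fst z \<in> A \<and> snd z = f (fst z)}"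
      by (auto simp: image_iff)
    then show ?thesis using F by (auto simp: image_image)
  qed
  obtain F1 :: "(('x \<times> 'y) \<times> (nat \<Rightarrow> nat discrete)) set" where
    F1: "closed F1" "f ` G = (\<lambda>w. snd (fst w)) ` F1" using graph[OF G] by blast
  obtain F2 :: "(('x \<times> 'y) \<times> (nat \<Rightarrow> nat discrete)) set" where
    F2: "closed F2" "f ` (- G) = (\<lambda>w. snd (fst w)) ` F2"
    using graph[OF borel_comp[OF G]] by blast
  \<comment> \<open>Saturation of \<open>G\<close> makes the two images disjoint, and the preimage
    of any Borel set separating them is \<open>G\<close>.\<close>
  have "borel_separated (f ` G) (f ` (- G))"
    unfolding F1(2) F2(2)
  proof (rule lusin_separation[OF _ F1(1) F2(1)])
    show "continuous_on UNIV (\<lambda>w :: ('x \<times> 'y) \<times> (nat \<Rightarrow> nat discrete). snd (fst w))"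
      by (intro continuous_intros)
    show "(\<lambda>w. snd (fst w)) ` F1 \<inter> (\<lambda>w. snd (fst w)) ` F2 = {}"
      unfolding F1(2)[symmetric] F2(2)[symmetric] using inv by blast
  qed
  then obtain D where "D \<in> sets borel" "f ` G \<subseteq> D" "D \<inter> f ` (- G) = {}"
    unfolding borel_separated_def by blast
  then show thesis using that[of D] by blast
qed

section \<open>Smooth state bisimulations\<close>

text \<open>Symmetry gives closure under complements: a step of \<open>R\<close> from the complement
  into an invariant set could be reversed.\<close>

lemma sets_sigma_invariant:
  assumes "symp R"
  shows "sigma_algebra UNIV (invariant_borel_sets R)"
    and "sets (sigma UNIV (invariant_borel_sets R)) = invariant_borel_sets R"
proof -
  show *: "sigma_algebra UNIV (invariant_borel_sets R)"
    unfolding sigma_algebra_iff2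
  proof (intro conjI ballI allI impI)
    show "UNIV - A \<in> invariant_borel_sets R" if "A \<in> invariant_borel_sets R" for A
      using that sympD[OF assms]
      by (auto simp: invariant_borel_sets_def invariant_set_def Compl_eq_Diff_UNIV[symmetric])
    show "(\<Union>i. A i) \<in> invariant_borel_sets R"
      if A: "range A \<subseteq> invariant_borel_sets R" for A :: "nat \<Rightarrow> _"
    proof -
      have "A i \<in> sets borel \<and> invariant_set R (A i)" for i
        using A unfolding invariant_borel_sets_def by blast
      then show ?thesis
        unfolding invariant_borel_sets_def invariant_set_def by blast
    qed
  qed (auto simp: invariant_borel_sets_def invariant_set_def)
  show "sets (sigma UNIV (invariant_borel_sets R)) = invariant_borel_sets R"
    using sigma_algebra.sets_measure_of_eq[OF *] by simp
qed

text \<open>The set \<open>B\<close> in \<open>P t\<close> supplied by the bisimulation lies inside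
  \<open>A\<close>, because \<open>A\<close> is closed under the lifting; upper closedness then puts
  \<open>A\<close> itself into \<open>P t\<close>.\<close>

lemma bisimulation_lift_closed:
  assumes P: "stochastic_effectivity_function P" and R: "state_bisimulation P R"
    and st: "R s t" and A: "A \<in> P s"
    and closed: "\<And>\<mu> \<nu>. \<mu> \<in> A \<Longrightarrow> \<nu> \<in> space (subprob_algebra borel) \<Longrightarrow> lift_rel R \<mu> \<nu> \<Longrightarrow> \<nu> \<in> A"
  shows "A \<in> P t"
proof -
  have sets: "X \<in> sets (subprob_algebra borel)" if "X \<in> P x" for X x
    using P that unfolding stochastic_effectivity_function_def by blast
  have "\<exists>B\<in>P t. \<forall>\<nu>\<in>B. \<exists>\<mu>\<in>A. lift_rel R \<mu> \<nu>"
    using R[unfolded state_bisimulation_def, THEN conjunct2, rule_format, OF st A] .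
  then obtain B where B: "B \<in> P t" "\<forall>\<nu>\<in>B. \<exists>\<mu>\<in>A. lift_rel R \<mu> \<nu>" ..
  have "B \<subseteq> A"
  proof
    fix \<nu> assume \<nu>: "\<nu> \<in> B"
    with B(2) obtain \<mu> where "\<mu> \<in> A" "lift_rel R \<mu> \<nu>" by blast
    moreover have "\<nu> \<in> space (subprob_algebra borel)"
      using sets.sets_into_space[OF sets[OF B(1)]] \<nu> by (rule subsetD)
    ultimately show "\<nu> \<in> A" using closed by blast
  qed
  then show ?thesis
    using P B(1) sets[OF A] unfolding stochastic_effectivity_function_def by blast
qed

lemma subsystem_smooth_bisimulation:
  fixes P :: "'a::polish_space \<Rightarrow> 'a measure set set"
  assumes P: "stochastic_effectivity_function P"
    and R: "state_bisimulation P R" and smooth: "smooth_equivalence R"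
  shows "subsystem P (invariant_borel_sets R)"
proof -
  let ?C = "invariant_borel_sets R"
  let ?N = "sigma UNIV ?C :: 'a measure"
  let ?I = unit_interval_borel
  have "symp R" using R unfolding state_bisimulation_def by blast
  note C = sets_sigma_invariant[OF this]
  have "?C \<subseteq> sets borel" by (auto simp: invariant_borel_sets_def)
  then have id[measurable]: "(\<lambda>x. x) \<in> borel \<rightarrow>\<^sub>M ?N"
    by (intro measurableI) (auto simp: C(2))
  let ?d = "\<lambda>\<mu>. distr \<mu> ?N (\<lambda>x. x)"
  have d[measurable]: "?d \<in> subprob_algebra borel \<rightarrow>\<^sub>M subprob_algebra ?N"
    by (rule measurable_distr[OF id])
  have d_eq: "?d \<mu> = ?d \<nu>" if "lift_rel R \<mu> \<nu>"
    "\<mu> \<in> space (subprob_algebra borel)" "\<nu> \<in> space (subprob_algebra borel)" for \<mu> \<nu>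
  proof (rule measure_eqI)
    fix X assume X: "X \<in> sets (?d \<mu>)"
    have [measurable_cong]: "sets \<mu> = sets borel" "sets \<nu> = sets borel"
      using that by (auto simp: space_subprob_algebra)
    have "space \<mu> = UNIV" "space \<nu> = UNIV"
      using sets_eq_imp_space_eq[of \<mu> borel] sets_eq_imp_space_eq[of \<nu> borel]
        that by (auto simp: space_subprob_algebra)
    with X that(1) show "emeasure (?d \<mu>) X = emeasure (?d \<nu>) X"
      by (simp add: emeasure_distr C(2) lift_rel_def)
  qed simp
  obtain E :: "nat \<Rightarrow> 'a set" where E: "\<And>n. E n \<in> sets borel" "\<And>s t. R s t \<longleftrightarrow> (\<forall>n. s \<in> E n \<longleftrightarrow> t \<in> E n)"
    using smooth unfolding smooth_equivalence_def by blast
  then have E_N: "E n \<in> sets ?N" for n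
    unfolding C(2) by (auto simp: invariant_borel_sets_def invariant_set_def)
  \<comment> \<open>The membership sequence for the sets \<open>E n\<close>. Its fibres are the
    classes of \<open>R\<close>, it is measurable already for the invariant sets, and its values lie
    in the Polish space \<open>nat => real\<close>.\<close>
  define code where "code s n = (indicator (E n) s :: real)" for s n
  have code_N[measurable]: "code \<in> borel_measurable ?N"
    unfolding code_def
    by (intro measurable_coordinatewise_then_product borel_measurable_indicator E_N)
  have code_borel[measurable]: "code \<in> borel_measurable borel"
    using measurable_compose[OF id code_N] by simp
  have code_eq: "R s t" if "code s = code t" for s t
    unfolding E(2)
  proof
    fix n
    show "s \<in> E n \<longleftrightarrow> t \<in> E n"
      using fun_cong[OF that, of n] by (simp add: code_def indicator_def of_bool_eq_iff)
  qed
  have "t_measurable ?N (restricted_effectivity P ?C)"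
    unfolding t_measurable_def
  proof
    fix H assume H[measurable]: "H \<in> sets (subprob_algebra ?N \<Otimes>\<^sub>M ?I)"
    \<comment> \<open>Pulling \<open>H\<close> back along the restriction map yields a set to which
      t-measurability of \<open>P\<close> applies.\<close>
    define H' where "H' = {z \<in> space (subprob_algebra borel \<Otimes>\<^sub>M ?I). (?d (fst z), snd z) \<in> H}"
    have H': "H' \<in> sets (subprob_algebra borel \<Otimes>\<^sub>M ?I)"
      unfolding H'_def by measurable
    define G where "G = {(s, q). s \<in> space borel \<and> q \<in> {0..1} \<and> {\<mu>. (\<mu>, q) \<in> H'} \<in> P s}"
    have G[measurable]: "G \<in> sets (borel \<Otimes>\<^sub>M ?I)"
      using P H' unfolding stochastic_effectivity_function_def t_measurable_def G_def by blast
    have fibre: "{\<mu>. (\<mu>, q) \<in> H'} = {\<mu> \<in> space (subprob_algebra borel). ?d \<mu> \<in> {\<mu>. (\<mu>, q) \<in> H}}"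
      if "q \<in> {0..1}" for q
      using that by (auto simp: H'_def space_pair_measure)
    \<comment> \<open>The sections of \<open>H'\<close> are the preimages under restriction that
      occur in \<open>restricted_effectivity\<close>, so the set to be measured is
      \<open>G\<close>.\<close>
    have G_eq: "{(s, q). s \<in> space ?N \<and> q \<in> {0..1} \<and> {\<mu>. (\<mu>, q) \<in> H} \<in> restricted_effectivity P ?C s} = G"
    proof -
      have "{\<mu>. (\<mu>, q) \<in> H} \<in> sets (subprob_algebra ?N)" for q
        using sets_Pair2[OF H, of q] by (simp add: vimage_def)
      then show ?thesis
        unfolding G_def restricted_effectivity_def by (auto simp: fibre)
    qed
    have G_inv: "(t, q) \<in> G" if "R s t" "(s, q) \<in> G" for s t q
    proof -
      have q: "q \<in> {0..1}" and H'q: "{\<mu>. (\<mu>, q) \<in> H'} \<in> P s" using that by (auto simp: G_def)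
      have "{\<mu>. (\<mu>, q) \<in> H'} \<in> P t"
      proof (rule bisimulation_lift_closed[OF P R that(1) H'q])
        fix \<mu> \<nu> assume \<mu>: "\<mu> \<in> {\<mu>. (\<mu>, q) \<in> H'}"
          and \<nu>: "\<nu> \<in> space (subprob_algebra borel)" and "lift_rel R \<mu> \<nu>"
        with fibre[OF q] d_eq[of \<mu> \<nu>] show "\<nu> \<in> {\<mu>. (\<mu>, q) \<in> H'}" by simp
      qed
      then show ?thesis using q by (simp add: G_def)
    qed
    \<comment> \<open>A retraction of the real line onto the unit interval. It extends
      \<open>G\<close> to a Borel subset of the Polish type \<open>'a * real\<close>, from which
      \<open>G\<close> is recovered on the interval, where \<open>clamp\<close> is the
      identity.\<close>
    define clamp where "clamp q = max 0 (min 1 q)" for q :: real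
    have clamp[measurable]: "clamp \<in> borel \<rightarrow>\<^sub>M ?I"
      unfolding clamp_def by (intro measurable_restrict_space2) auto
    define f where "f z = (code (fst z), snd z)" for z :: "'a \<times> real"
    have f_borel: "f \<in> borel_measurable borel"
      unfolding f_def borel_prod[symmetric] by measurable
    have "{z \<in> space (borel \<Otimes>\<^sub>M borel). (fst z, clamp (snd z)) \<in> G} \<in> sets (borel \<Otimes>\<^sub>M borel)"
      by measurable
    then have G': "{z. (fst z, clamp (snd z)) \<in> G} \<in> sets borel"
      unfolding borel_prod by simp
    have G'_inv: "z' \<in> {z. (fst z, clamp (snd z)) \<in> G}"
      if "f z = f z'" "z \<in> {z. (fst z, clamp (snd z)) \<in> G}" for z z'
      using that G_inv[OF code_eq, of "fst z" "fst z'" "clamp (snd z)"] by (simp add: f_def)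
    obtain D where D: "D \<in> sets borel" "{z. (fst z, clamp (snd z)) \<in> G} = f -` D"
      by (rule blackwell_mackey[OF f_borel G' G'_inv])
    \<comment> \<open>The same \<open>f\<close> is measurable for the smaller product sigma-algebra
      \<open>?N \<Otimes>\<^sub>M ?I\<close>, so the preimage of \<open>D\<close> belongs to
      it.\<close>
    have "D \<in> sets (borel \<Otimes>\<^sub>M borel)" unfolding borel_prod by (rule D(1))
    moreover have "snd \<in> ?N \<Otimes>\<^sub>M ?I \<rightarrow>\<^sub>M borel"
      by (rule measurable_compose[OF measurable_snd measurable_restrict_space1]) simp
    then have "f \<in> ?N \<Otimes>\<^sub>M ?I \<rightarrow>\<^sub>M borel \<Otimes>\<^sub>M borel"
      unfolding f_def by measurable
    ultimately have "f -` D \<inter> space (?N \<Otimes>\<^sub>M ?I) \<in> sets (?N \<Otimes>\<^sub>M ?I)"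
      by (rule measurable_sets[rotated])
    also have "f -` D \<inter> space (?N \<Otimes>\<^sub>M ?I) = G"
      unfolding D(2)[symmetric] by (auto simp: space_pair_measure G_def clamp_def)
    finally show "{(s, q). s \<in> space ?N \<and> q \<in> {0..1} \<and>
        {\<mu>. (\<mu>, q) \<in> H} \<in> restricted_effectivity P ?C s} \<in> sets (?N \<Otimes>\<^sub>M ?I)"
      unfolding G_eq .
  qed
  with C(1) \<open>?C \<subseteq> sets borel\<close> show ?thesis unfolding subsystem_def by blast
qed

section \<open>A countable logic for finitary stochastic effectivity functions\<close>

text \<open>
  Every formula denotes a Borel set invariant under all state bisimulations. Boolean connectives
  on the level of measures are needed because \<open>P s\<close> is described by finite families of finite sets:
  separating two such families takes a finite combination of threshold conditions.
\<close>

datatype state_formula = Truth | Conj state_formula state_formula | Modal measure_formula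
  and measure_formula = Above state_formula rat | Neg measure_formula
    | Both measure_formula measure_formula

instance state_formula :: countable by countable_datatype

primrec state_sem :: "('a::topological_space \<Rightarrow> 'a measure set set) \<Rightarrow> state_formula \<Rightarrow> 'a set"
  and measure_sem :: "('a \<Rightarrow> 'a measure set set) \<Rightarrow> measure_formula \<Rightarrow> 'a measure set" where
  "state_sem P Truth = UNIV"
| "state_sem P (Conj \<phi> \<psi>) = state_sem P \<phi> \<inter> state_sem P \<psi>"
| "state_sem P (Modal \<theta>) = {s. measure_sem P \<theta> \<in> P s}"
| "measure_sem P (Above \<phi> q) =
    {\<mu> \<in> space (subprob_algebra borel). measure \<mu> (state_sem P \<phi>) > real_of_rat q}"
| "measure_sem P (Neg \<theta>) = space (subprob_algebra borel) - measure_sem P \<theta>"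
| "measure_sem P (Both \<theta> \<eta>) = measure_sem P \<theta> \<inter> measure_sem P \<eta>"

section \<open>Measurability, invariance and smoothness of the logic\<close>

definition logically_equivalent ::
  "('a::topological_space \<Rightarrow> 'a measure set set) \<Rightarrow> 'a \<Rightarrow> 'a \<Rightarrow> bool" where
  "logically_equivalent P s t \<longleftrightarrow> (\<forall>\<phi>. s \<in> state_sem P \<phi> \<longleftrightarrow> t \<in> state_sem P \<phi>)"

text \<open>Every section of the cylinder over \<open>D\<close> at a point of the unit interval is
  \<open>D\<close>, so t-measurability for the cylinder gives the claim after cutting at
  \<open>q = 0\<close>.\<close>

lemma sets_modal:
  assumes "t_measurable M P" and D: "D \<in> sets (subprob_algebra M)"
  shows "{s \<in> space M. D \<in> P s} \<in> sets M"
proof -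
  let ?H = "D \<times> {0..1::real}"
  have "?H \<in> sets (subprob_algebra M \<Otimes>\<^sub>M unit_interval_borel)"
    using D sets.top[of unit_interval_borel] by (intro pair_measureI) auto
  then have "{(s, q). s \<in> space M \<and> q \<in> {0..1} \<and> {\<mu>. (\<mu>, q) \<in> ?H} \<in> P s}
      \<in> sets (M \<Otimes>\<^sub>M unit_interval_borel)"
    using assms(1) unfolding t_measurable_def by blast
  from sets_Pair2[OF this, of 0] show ?thesis by (simp add: vimage_def)
qed

lemma sem_measurable:
  assumes P: "t_measurable borel P"
  shows "state_sem P \<phi> \<in> sets borel" "measure_sem P \<theta> \<in> sets (subprob_algebra borel)"
proof (induction \<phi> and \<theta>)
  case (Modal \<theta>)
  then show ?case using sets_modal[OF P] by simp
next
  case (Above \<phi> q)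
  then have [measurable]: "state_sem P \<phi> \<in> sets borel" .
  show ?case unfolding measure_sem.simps by measurable
qed auto

text \<open>The two halves feed each other: an invariant denotation has equal mass under lifted
  measures, which settles \<open>Above\<close>, and a denotation closed under the lifting passes
  along \<open>R\<close> by \<open>bisimulation_lift_closed\<close>, which settles
  \<open>Modal\<close>.\<close>

lemma sem_bisimulation_invariant:
  assumes P: "stochastic_effectivity_function P" and R: "state_bisimulation P R"
  shows "invariant_set R (state_sem P \<phi>)"
    and "\<forall>\<mu> \<nu>. \<nu> \<in> space (subprob_algebra borel) \<longrightarrow> lift_rel R \<mu> \<nu> \<longrightarrow>
      \<mu> \<in> space (subprob_algebra borel) \<longrightarrow> \<mu> \<in> measure_sem P \<theta> \<longleftrightarrow> \<nu> \<in> measure_sem P \<theta>"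
proof (induction \<phi> and \<theta>)
  case (Modal \<theta>)
  show ?case unfolding invariant_set_def state_sem.simps mem_Collect_eq
  proof (intro allI impI)
    fix s t assume "measure_sem P \<theta> \<in> P s" "R s t"
    moreover have "measure_sem P \<theta> \<subseteq> space (subprob_algebra borel)"
      using P sem_measurable(2) sets.sets_into_space
      unfolding stochastic_effectivity_function_def by metis
    ultimately show "measure_sem P \<theta> \<in> P t"
      using bisimulation_lift_closed[OF P R, of s t "measure_sem P \<theta>"] Modal by blast
  qed
next
  case (Above \<phi> q)
  then have "state_sem P \<phi> \<in> invariant_borel_sets R"
    using P sem_measurable
    unfolding stochastic_effectivity_function_def invariant_borel_sets_def by blast
  then show ?case by (simp add: lift_rel_def measure_def)
qed (auto simp: invariant_set_def)

text \<open>There are only countably many formulas, and each denotes a Borel set.\<close>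

lemma smooth_logically_equivalent:
  assumes "t_measurable borel P"
  shows "smooth_equivalence (logically_equivalent P)"
  unfolding smooth_equivalence_def
proof
  show "equivp (logically_equivalent P)"
    by (intro equivpI reflpI sympI transpI) (auto simp: logically_equivalent_def)
  have "logically_equivalent P s t \<longleftrightarrow>
      (\<forall>n. s \<in> state_sem P (from_nat n) \<longleftrightarrow> t \<in> state_sem P (from_nat n))" for s t
    unfolding logically_equivalent_def by (metis from_nat_to_nat)
  then show "\<exists>C :: nat \<Rightarrow> _. (\<forall>n. C n \<in> sets borel) \<and>
      (\<forall>s t. logically_equivalent P s t \<longleftrightarrow> (\<forall>n. s \<in> C n \<longleftrightarrow> t \<in> C n))"
    using sem_measurable(1)[OF assms] by (intro exI[of _ "\<lambda>n. state_sem P (from_nat n)"]) auto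
qed

text \<open>The truth values of all formulas form a map \<open>code\<close> whose kernel is logical
  equivalence. By Blackwell-Mackey an invariant Borel set is a preimage under \<open>code\<close>,
  which is measurable for the sigma-algebra of denotations.\<close>

lemma invariant_sets_generated:
  fixes P :: "'a::polish_space \<Rightarrow> 'a measure set set"
  assumes P: "t_measurable borel P" and A: "A \<in> invariant_borel_sets (logically_equivalent P)"
  shows "A \<in> sigma_sets UNIV (range (state_sem P))"
proof -
  let ?N = "sigma UNIV (range (state_sem P)) :: 'a measure"
  define code where "code s n = (indicator (state_sem P (from_nat n)) s :: real)" for s :: 'a and n :: nat
  have N: "code \<in> borel_measurable ?N"
    unfolding code_def
    by (intro measurable_coordinatewise_then_product borel_measurable_indicator) auto
  have borel: "code \<in> borel_measurable borel"
    unfolding code_def using sem_measurable(1)[OF P]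
    by (intro measurable_coordinatewise_then_product borel_measurable_indicator) auto
  have eq: "logically_equivalent P s t" if "code s = code t" for s t
    unfolding logically_equivalent_def
  proof
    fix \<phi> :: state_formula
    have "code s (to_nat \<phi>) = code t (to_nat \<phi>)" using that by simp
    then show "s \<in> state_sem P \<phi> \<longleftrightarrow> t \<in> state_sem P \<phi>"
      by (simp add: code_def indicator_def of_bool_eq_iff)
  qed
  have A': "A \<in> sets borel" "invariant_set (logically_equivalent P) A"
    using A by (auto simp: invariant_borel_sets_def)
  then have inv: "t \<in> A" if "code s = code t" "s \<in> A" for s t
    using eq that unfolding invariant_set_def by blast
  obtain D where "D \<in> sets borel" "A = code -` D"
    by (rule blackwell_mackey[OF borel A'(1) inv])
  then show ?thesis using measurable_sets[OF N, of D] by simp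
qed

text \<open>\<open>Conj\<close> makes the denotations intersection stable and \<open>Truth\<close>
  contributes the whole space, so finite measures agreeing on them agree on the generated
  sigma-algebra, hence on all invariant Borel sets.\<close>

lemma lift_logically_equivalentI:
  fixes P :: "'a::polish_space \<Rightarrow> 'a measure set set"
  assumes P: "t_measurable borel P"
    and \<mu>: "\<mu> \<in> space (subprob_algebra borel)" and \<nu>: "\<nu> \<in> space (subprob_algebra borel)"
    and eq: "\<And>\<phi>. measure \<mu> (state_sem P \<phi>) = measure \<nu> (state_sem P \<phi>)"
  shows "lift_rel (logically_equivalent P) \<mu> \<nu>"
  unfolding lift_rel_def
proof
  fix A assume A: "A \<in> invariant_borel_sets (logically_equivalent P)"
  let ?N = "sigma UNIV (range (state_sem P)) :: 'a measure"
  interpret \<mu>: subprob_space \<mu> using \<mu> by (simp add: space_subprob_algebra)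
  interpret \<nu>: subprob_space \<nu> using \<nu> by (simp add: space_subprob_algebra)
  have [measurable_cong]: "sets \<mu> = sets borel" "sets \<nu> = sets borel"
    using \<mu> \<nu> by (auto simp: space_subprob_algebra)
  then have sp: "space \<mu> = UNIV" "space \<nu> = UNIV"
    using sets_eq_imp_space_eq[of \<mu> borel] sets_eq_imp_space_eq[of \<nu> borel] by auto
  have [measurable]: "(\<lambda>x. x) \<in> borel \<rightarrow>\<^sub>M ?N"
    using sem_measurable(1)[OF P] by (intro measurable_measure_of) auto
  have d: "emeasure (distr \<rho> ?N (\<lambda>x. x)) X = emeasure \<rho> X"
    if "X \<in> sets ?N" "sets \<rho> = sets borel" for X and \<rho> :: "'a measure"
  proof -
    have [measurable_cong]: "sets \<rho> = sets borel" by fact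
    show ?thesis using that sets_eq_imp_space_eq[of \<rho> borel] by (simp add: emeasure_distr)
  qed
  \<comment> \<open>The uniqueness theorem is applied to the restrictions to \<open>?N\<close>,
    whose sigma-algebra is generated by the denotations.\<close>
  have "distr \<mu> ?N (\<lambda>x. x) = distr \<nu> ?N (\<lambda>x. x)"
  proof (rule measure_eqI_generator_eq[where E = "range (state_sem P)" and \<Omega> = UNIV
        and A = "\<lambda>_. UNIV"])
    show "Int_stable (range (state_sem P))"
      by (auto simp: Int_stable_def simp flip: state_sem.simps(2))
    show "range (\<lambda>_::nat. UNIV) \<subseteq> range (state_sem P)"
      by (auto intro!: image_eqI[of _ _ Truth])
    fix X assume "X \<in> range (state_sem P)"
    then show "emeasure (distr \<mu> ?N (\<lambda>x. x)) X = emeasure (distr \<nu> ?N (\<lambda>x. x)) X"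
      using eq \<open>sets \<mu> = sets borel\<close> \<open>sets \<nu> = sets borel\<close>
      by (auto simp: d \<mu>.emeasure_eq_measure \<nu>.emeasure_eq_measure)
  next
    show "emeasure (distr \<mu> ?N (\<lambda>x. x)) UNIV \<noteq> \<infinity>"
      using d[of UNIV \<mu>] \<open>sets \<mu> = sets borel\<close> sets.top[of ?N]
      by (simp add: \<mu>.emeasure_eq_measure)
  qed auto
  moreover have "A \<in> sets ?N" using invariant_sets_generated[OF P A] by simp
  ultimately show "emeasure \<mu> A = emeasure \<nu> A"
    using d[of A \<mu>] d[of A \<nu>] \<open>sets \<mu> = sets borel\<close> \<open>sets \<nu> = sets borel\<close> by simp
qed

section \<open>Separating finite sets of measures by formulas\<close>

lemma algebra_measure_sem:
  assumes "t_measurable borel P"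
  shows "algebra (space (subprob_algebra borel)) (range (measure_sem P))"
  unfolding algebra_iff_Int
proof (intro conjI ballI)
  show "range (measure_sem P) \<subseteq> Pow (space (subprob_algebra borel))"
    using sets.sets_into_space[OF sem_measurable(2)[OF assms]] by blast
  show "{} \<in> range (measure_sem P)"
    by (rule image_eqI[of _ _ "Both (Above Truth 0) (Neg (Above Truth 0))"]) auto
next
  fix A assume "A \<in> range (measure_sem P)"
  then obtain \<theta> where "A = measure_sem P \<theta>" by blast
  then show "space (subprob_algebra borel) - A \<in> range (measure_sem P)"
    by (intro image_eqI[of _ _ "Neg \<theta>"]) auto
next
  fix A B assume "A \<in> range (measure_sem P)" "B \<in> range (measure_sem P)"
  then obtain \<theta> \<eta> where "A = measure_sem P \<theta>" "B = measure_sem P \<eta>" by blast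
  then show "A \<inter> B \<in> range (measure_sem P)"
    by (intro image_eqI[of _ _ "Both \<theta> \<eta>"]) auto
qed

text \<open>For fixed \<open>y\<close> the union of the \<open>D x y\<close> over \<open>x\<close>
  in \<open>K\<close> covers \<open>K\<close> and misses \<open>y\<close>; intersecting over
  \<open>y\<close> in \<open>L\<close> misses all of \<open>L\<close>. The intersection is written
  with complements, so that an empty \<open>L\<close> yields \<open>\<Omega>\<close>.\<close>

lemma (in algebra) separate_finite_sets:
  assumes "finite K" "finite L" "K \<subseteq> \<Omega>" "L \<subseteq> \<Omega>"
    and sep: "\<And>x y. x \<in> K \<Longrightarrow> y \<in> L \<Longrightarrow> \<exists>D\<in>M. x \<in> D \<and> y \<notin> D"
  obtains D where "D \<in> M" "K \<subseteq> D" "D \<inter> L = {}"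
proof -
  obtain D where D: "\<And>x y. x \<in> K \<Longrightarrow> y \<in> L \<Longrightarrow> D x y \<in> M \<and> x \<in> D x y \<and> y \<notin> D x y"
    using sep by metis
  have "(\<Union>y\<in>L. \<Omega> - (\<Union>x\<in>K. D x y)) \<in> M"
    using assms(1,2) D by (intro finite_UN compl_sets) auto
  then have "\<Omega> - (\<Union>y\<in>L. \<Omega> - (\<Union>x\<in>K. D x y)) \<in> M" by (rule compl_sets)
  moreover have "K \<subseteq> \<Omega> - (\<Union>y\<in>L. \<Omega> - (\<Union>x\<in>K. D x y))" using D assms(3) by blast
  moreover have "(\<Omega> - (\<Union>y\<in>L. \<Omega> - (\<Union>x\<in>K. D x y))) \<inter> L = {}" using D assms(4) by blast
  ultimately show thesis using that by blast
qed

text \<open>A rational strictly between the two masses serves as threshold; \<open>Neg\<close> is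
  used when \<open>\<mu>\<close> has the smaller one.\<close>

lemma measure_sem_separates:
  assumes "\<mu> \<in> space (subprob_algebra borel)" "\<nu> \<in> space (subprob_algebra borel)"
    and "measure \<mu> (state_sem P \<phi>) \<noteq> measure \<nu> (state_sem P \<phi>)"
  shows "\<exists>D \<in> range (measure_sem P). \<mu> \<in> D \<and> \<nu> \<notin> D"
proof (cases "measure \<mu> (state_sem P \<phi>) < measure \<nu> (state_sem P \<phi>)")
  case True
  then obtain q where "measure \<mu> (state_sem P \<phi>) < real_of_rat q" "real_of_rat q < measure \<nu> (state_sem P \<phi>)"
    using of_rat_dense by blast
  then show ?thesis using assms by (intro bexI[of _ "measure_sem P (Neg (Above \<phi> q))"] rangeI) auto
next
  case False
  then obtain q where "measure \<nu> (state_sem P \<phi>) < real_of_rat q" "real_of_rat q < measure \<mu> (state_sem P \<phi>)"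
    using of_rat_dense assms(3) by (metis linorder_neqE)
  then show ?thesis using assms by (intro bexI[of _ "measure_sem P (Above \<phi> q)"] rangeI) auto
qed

text \<open>The answer to \<open>A\<close> is the set \<open>B\<close> of measures that agree on all
  formulas with a member of a finite generator of \<open>P s\<close> contained in \<open>A\<close>.
  If \<open>B\<close> were not in \<open>P t\<close>, a formula would separate that generator from
  points chosen outside \<open>B\<close>, one in each generator of \<open>P t\<close>, and its
  modality would distinguish \<open>s\<close> from \<open>t\<close>.\<close>

lemma logically_equivalent_bisimulation:
  fixes P :: "'a::polish_space \<Rightarrow> 'a measure set set"
  assumes P: "stochastic_effectivity_function P" and fin: "finitary P"
  shows "state_bisimulation P (logically_equivalent P)"
  unfolding state_bisimulation_def
proof (intro conjI allI impI ballI)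
  show "symp (logically_equivalent P)" by (auto intro!: sympI simp: logically_equivalent_def)
next
  fix s t A assume st: "logically_equivalent P s t" and A: "A \<in> P s"
  let ?S = "space (subprob_algebra (borel :: 'a measure))"
  have tm: "t_measurable borel P" using P unfolding stochastic_effectivity_function_def by blast
  have fin': "\<exists>K. finite K \<and> (\<forall>\<kappa>\<in>K. finite \<kappa> \<and> \<kappa> \<subseteq> ?S) \<and> P x = (\<Union>\<kappa>\<in>K. principal_filter \<kappa>)" for x
    using fin unfolding finitary_def by blast
  obtain K where K: "\<And>\<kappa>. \<kappa> \<in> K \<Longrightarrow> finite \<kappa> \<and> \<kappa> \<subseteq> ?S" "P s = (\<Union>\<kappa>\<in>K. principal_filter \<kappa>)"
    using fin'[of s] by metis
  obtain \<kappa> where "\<kappa> \<in> K" "A \<in> principal_filter \<kappa>" using A unfolding K(2) by blast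
  then have \<kappa>: "finite \<kappa>" "\<kappa> \<subseteq> ?S" "principal_filter \<kappa> \<subseteq> P s" "\<kappa> \<subseteq> A"
    using K(1)[of \<kappa>] unfolding K(2) principal_filter_def by auto
  obtain L where L: "finite L" "\<And>\<xi>. \<xi> \<in> L \<Longrightarrow> finite \<xi> \<and> \<xi> \<subseteq> ?S" "P t = (\<Union>\<xi>\<in>L. principal_filter \<xi>)"
    using fin'[of t] by metis
  define B where "B = (\<Union>\<mu>\<in>\<kappa>. {\<nu> \<in> ?S. \<forall>\<phi>. measure \<nu> (state_sem P \<phi>) = measure \<mu> (state_sem P \<phi>)})"
  have [measurable]: "state_sem P \<phi> \<in> sets borel" for \<phi> by (rule sem_measurable(1)[OF tm])
  \<comment> \<open>Countability of the formulas makes each class of measures measurable, and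
    \<open>\<kappa>\<close> is finite.\<close>
  have B_sets: "B \<in> sets (subprob_algebra borel)"
    unfolding B_def using \<kappa>(1) by (intro sets.finite_UN) measurable
  have "B \<in> P t"
  proof (rule ccontr)
    assume "B \<notin> P t"
    then have "\<forall>\<xi>\<in>L. \<exists>\<nu>\<in>\<xi>. \<nu> \<notin> B"
      using B_sets unfolding L(3) principal_filter_def by blast
    then obtain c where c: "\<And>\<xi>. \<xi> \<in> L \<Longrightarrow> c \<xi> \<in> \<xi> \<and> c \<xi> \<notin> B" by metis
    interpret algebra ?S "range (measure_sem P)" by (rule algebra_measure_sem[OF tm])
    have cS: "c ` L \<subseteq> ?S" using c L(2) by blast
    have "\<exists>D\<in>range (measure_sem P). \<mu> \<in> D \<and> \<nu> \<notin> D" if "\<mu> \<in> \<kappa>" "\<nu> \<in> c ` L" for \<mu> \<nu>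
    proof -
      have "\<nu> \<notin> B" "\<nu> \<in> ?S" using that c cS by blast+
      then have "\<not> (\<forall>\<phi>. measure \<nu> (state_sem P \<phi>) = measure \<mu> (state_sem P \<phi>))"
        using that(1) by (simp add: B_def)
      then obtain \<phi> where "measure \<mu> (state_sem P \<phi>) \<noteq> measure \<nu> (state_sem P \<phi>)"
        by (metis (no_types))
      moreover have "\<mu> \<in> ?S" using that(1) \<kappa>(2) by blast
      ultimately show ?thesis by (intro measure_sem_separates \<open>\<nu> \<in> ?S\<close>)
    qed
    then obtain D where D: "D \<in> range (measure_sem P)" "\<kappa> \<subseteq> D" "D \<inter> c ` L = {}"
      using separate_finite_sets[OF \<kappa>(1) finite_imageI[OF L(1)] \<kappa>(2) cS] by blast
    then obtain \<theta> where \<theta>: "D = measure_sem P \<theta>" by blast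
    have "D \<in> P s"
      using D(2) \<kappa>(3) sem_measurable(2)[OF tm] unfolding \<theta> principal_filter_def by blast
    then have "D \<in> P t"
      using st unfolding logically_equivalent_def \<theta> by (metis (mono_tags) mem_Collect_eq state_sem.simps(3))
    \<comment> \<open>A generator inside \<open>D\<close> contains its chosen point
      \<open>c \<xi>\<close>, which \<open>D\<close> avoids.\<close>
    then obtain \<xi> where "\<xi> \<in> L" "\<xi> \<subseteq> D" unfolding L(3) principal_filter_def by blast
    then show False using c D(3) by blast
  qed
  moreover have "\<exists>\<mu>\<in>A. lift_rel (logically_equivalent P) \<mu> \<nu>" if \<nu>: "\<nu> \<in> B" for \<nu>
  proof -
    obtain \<mu> where "\<mu> \<in> \<kappa>" "\<nu> \<in> ?S" "\<forall>\<phi>. measure \<nu> (state_sem P \<phi>) = measure \<mu> (state_sem P \<phi>)"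
      using \<nu> unfolding B_def by blast
    then have "lift_rel (logically_equivalent P) \<mu> \<nu>"
      using \<kappa>(2) by (intro lift_logically_equivalentI[OF tm]) auto
    with \<open>\<mu> \<in> \<kappa>\<close> \<kappa>(4) show ?thesis by blast
  qed
  ultimately show "\<exists>B\<in>P t. \<forall>\<nu>\<in>B. \<exists>\<mu>\<in>A. lift_rel (logically_equivalent P) \<mu> \<nu>" by blast
qed

text \<open>Logical equivalence is itself a bisimulation; conversely, denotations are invariant
  under every bisimulation, and symmetry turns invariance into equivalence of truth values.\<close>

lemma state_bisimilar_eq_logically_equivalent:
  fixes P :: "'a::polish_space \<Rightarrow> 'a measure set set"
  assumes P: "stochastic_effectivity_function P" and fin: "finitary P"
  shows "state_bisimilar P = logically_equivalent P"
proof (intro ext iffI)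
  fix s t assume "logically_equivalent P s t"
  then show "state_bisimilar P s t"
    using logically_equivalent_bisimulation[OF assms] unfolding state_bisimilar_def by blast
next
  fix s t assume "state_bisimilar P s t"
  then obtain R where R: "state_bisimulation P R" "R s t" unfolding state_bisimilar_def by blast
  then have "R t s" unfolding state_bisimulation_def by (blast dest: sympD)
  with R show "logically_equivalent P s t"
    using sem_bisimulation_invariant(1)[OF P R(1)]
    unfolding logically_equivalent_def invariant_set_def by blast
qed

theorem theorem5p15:
  fixes P :: "'a::polish_space \<Rightarrow> 'a measure set set"
  assumes "stochastic_effectivity_function P"
  shows "(\<forall>R. state_bisimulation_equivalence P R \<and> smooth_equivalence R \<longrightarrow>
            subsystem P (invariant_borel_sets R)) \<and>
         (finitary P \<longrightarrow> subsystem P (invariant_borel_sets (state_bisimilar P)))"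
proof (intro conjI allI impI)
  fix R assume "state_bisimulation_equivalence P R \<and> smooth_equivalence R"
  then show "subsystem P (invariant_borel_sets R)"
    using subsystem_smooth_bisimulation[OF assms] unfolding state_bisimulation_equivalence_def by blast
next
  assume fin: "finitary P"
  have "t_measurable borel P" using assms unfolding stochastic_effectivity_function_def by blast
  \<comment> \<open>Rewritten as logical equivalence, bisimilarity is a smooth state bisimulation,
    so the first result applies.\<close>
  then show "subsystem P (invariant_borel_sets (state_bisimilar P))"
    unfolding state_bisimilar_eq_logically_equivalent[OF assms fin]
    by (intro subsystem_smooth_bisimulation[OF assms] logically_equivalent_bisimulation[OF assms fin]
        smooth_logically_equivalent)
qed

end
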